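(* Let $G$ be a finite simple graph of order $n$, with maximum degree $\Delta$ and girth at least $5$. Let $\mu(G)$ denote the largest eigenvalue of the adjacency matrix of $G$. Then \[ \mu(G)\leq\min\left\{\Delta,\sqrt{n-1}\right\}. \] Moreover, equality holds if and only if one of the following conditions holds: (i) $G=K_{1,n-1}$; (ii) $G$ is a $\Delta$-regular Moore graph of diameter $2$; (iii) $G=G_1\cup G_2$ (vertex-disjoint union), where $G_1$ is $\Delta$-regular, $\Delta(G_2)\leq\Delta$, and both $G_1$ and $G_2$ have girth at least $5$.
   Context: Graphs are finite and simple. The girth of a graph is the length of its shortest cycle (infinite if the graph has no cycles), so "girth at least 5" means $G$ contains no triangle and no 4-cycle. $\Delta(H)$ denotes the maximum degree of a graph $H$. A $\Delta$-regular Moore graph of diameter $2$ is a $\Delta$-regular graph of diameter $2$ with exactly $\Delta^2+1$ vertices (equivalently, a $\Delta$-regular graph of diameter $2$ and girth $5$). $G_1\cup G_2$ denotes the disjoint union of graphs $G_1$ and $G_2$. *)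

theory Defs
  imports
    "Graph_Theory.Graph_Theory"
    "Jordan_Normal_Form.Spectral_Radius"
begin

text \<open>
  A finite simple graph is a \<^locale>\<open>pair_graph\<close>: a finite symmetric loop-free relation on a finite
  vertex set. Every undirected edge is represented by its two arcs, so the out-degree of a vertex is
  its degree.
\<close>

text \<open>The inserted \<open>0\<close> fixes the maximum degree of the null graph and matters nowhere else.\<close>

definition max_degree :: "('a, 'b) pre_digraph \<Rightarrow> nat" where
  "max_degree G = Max (insert 0 (out_degree G ` verts G))"

definition regular_graph :: "nat \<Rightarrow> ('a, 'b) pre_digraph \<Rightarrow> bool" where
  "regular_graph d G \<longleftrightarrow> (\<forall>v \<in> verts G. out_degree G v = d)"

text \<open>
  In a symmetric digraph, traversing an edge back and forth is a \<^const>\<open>pre_digraph.cycle\<close>; the cycles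
  of the underlying undirected simple graph are those of length at least \<open>3\<close>. The infimum over the
  empty set is \<open>\<infinity>\<close>, the girth of a graph without cycles.
\<close>

definition girth :: "('a, 'b) pre_digraph \<Rightarrow> enat" where
  "girth G = (INF p \<in> {p. pre_digraph.cycle G p \<and> 3 \<le> length p}. enat (length p))"

text \<open>
  \<^const>\<open>wf_digraph.\<mu>\<close> with unit weights is the usual distance, which is \<open>\<infinity>\<close> between vertices of
  different components.
\<close>

definition graph_diameter :: "('a, 'b) pre_digraph \<Rightarrow> ereal" where
  "graph_diameter G = (SUP u \<in> verts G. SUP v \<in> verts G. wf_digraph.\<mu> G (\<lambda>_. 1) u v)"

definition moore_graph_diameter2 :: "nat \<Rightarrow> ('a, 'b) pre_digraph \<Rightarrow> bool" where
  "moore_graph_diameter2 d G \<longleftrightarrow>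
    regular_graph d G \<and> graph_diameter G = 2 \<and> card (verts G) = d\<^sup>2 + 1"

text \<open>
  The list \<open>vs\<close> enumerates the vertices without repetition. Different enumerations give
  permutation-similar matrices, hence the same spectrum.
\<close>

definition adjacency_matrix :: "'a list \<Rightarrow> ('a, 'b) pre_digraph \<Rightarrow> real mat" where
  "adjacency_matrix vs G =
    mat (length vs) (length vs) (\<lambda>(i, j). if (vs ! i, vs ! j) \<in> arcs_ends G then 1 else 0)"

text \<open>
  Only applied to adjacency matrices of graphs with at least one vertex, which are real symmetric, so
  that the real spectrum is finite, non-empty and contains all complex eigenvalues.
\<close>

definition largest_eigenvalue :: "real mat \<Rightarrow> real" where
  "largest_eigenvalue A = Max (spectrum A)"

end

theory Submission
  imports Defs
begin

text \<open>
  Let \<open>f\<close> be an eigenfunction for the eigenvalue \<open>k\<close>, and \<open>v\<close> a vertex with \<open>\<bar>f v\<bar>\<close> maximal. Summing \<open>f\<close>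
  over the neighbours of \<open>v\<close> gives \<open>k \<le> \<Delta>\<close>. Summing it over the walks of length two from \<open>v\<close> bounds
  \<open>k\<^sup>2\<close> by the sum of the degrees of the neighbours of \<open>v\<close>, and in girth at least \<open>5\<close> that sum counts the
  vertices other than \<open>v\<close> within distance two, hence \<open>k\<^sup>2 \<le> n - 1\<close>. Equality forces \<open>f\<close> to take the value
  \<open>f v\<close> at all end points. In the first case the set where \<open>f\<close> equals \<open>f v\<close> is \<open>\<Delta>\<close>-regular and closed
  under adjacency; in the second the graph is a star or \<open>f\<close> is constant, so that the graph is
  \<open>k\<close>-regular. Conversely, stars have the eigenvalue \<open>sqrt (n - 1)\<close> and regular parts the eigenvalue
  \<open>\<Delta>\<close>, and the bounds do the rest: a Moore graph is just a regular part.
\<close>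

section \<open>Real eigenvalues of symmetric matrices\<close>

lemma eigenvector_sum:
  assumes "A \<in> carrier_mat n n" "eigenvector A v k" "i < n"
  shows "(\<Sum>j<n. A $$ (i, j) * v $ j) = k * v $ i"
proof -
  have "(A *\<^sub>v v) $ i = k * v $ i" "dim_vec v = n"
    using assms unfolding eigenvector_def by auto
  then show ?thesis
    using assms by (simp add: scalar_prod_def lessThan_atLeast0)
qed

text \<open>Needed so that the \<open>Max\<close> in \<open>largest_eigenvalue\<close> is attained.
  Over the complex numbers some eigenvalue \<open>k\<close> with eigenvector \<open>z\<close>
  exists. The Hermitian form \<open>Q\<close> of the matrix at \<open>z\<close> equals
  \<open>k\<close> times the squared norm \<open>s\<close> of \<open>z\<close>, and conjugating
  \<open>Q\<close> only transposes the matrix. Hence \<open>k\<close> is real, and it is a root of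
  the real characteristic polynomial as well.\<close>

lemma symmetric_spectrum_non_empty:
  fixes A :: "real mat"
  assumes A: "A \<in> carrier_mat n n" and n: "0 < n"
    and sym: "\<And>i j. i < n \<Longrightarrow> j < n \<Longrightarrow> A $$ (i, j) = A $$ (j, i)"
  shows "spectrum A \<noteq> {}"
proof -
  let ?C = "map_mat complex_of_real A"
  have C: "?C \<in> carrier_mat n n" using A by simp
  obtain k z where z: "eigenvector ?C z k"
    using spectrum_non_empty[OF C n] unfolding spectrum_def eigenvalue_def by auto
  have zn: "z \<in> carrier_vec n" and z0: "z \<noteq> 0\<^sub>v n"
    using z A unfolding eigenvector_def by auto
  have row: "(\<Sum>j<n. of_real (A $$ (i, j)) * z $ j) = k * z $ i" if "i < n" for i
    using eigenvector_sum[OF C z that] that A by simp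
  define s where "s = (\<Sum>i<n. (cmod (z $ i))\<^sup>2)"
  define Q where "Q = (\<Sum>i<n. \<Sum>j<n. of_real (A $$ (i, j)) * z $ j * cnj (z $ i))"
  have "Q = (\<Sum>i<n. k * (z $ i * cnj (z $ i)))"
    unfolding Q_def sum_distrib_right[symmetric] by (intro sum.cong) (auto simp: row)
  also have "\<dots> = k * of_real s"
    by (simp add: s_def sum_distrib_left complex_norm_square del: of_real_power)
  finally have Q: "Q = k * of_real s" .
  have "cnj Q = (\<Sum>i<n. \<Sum>j<n. of_real (A $$ (j, i)) * z $ i * cnj (z $ j))"
    unfolding Q_def cnj_sum by (intro sum.cong) (auto simp: sym)
  also have "\<dots> = Q" unfolding Q_def by (rule sum.swap)
  finally have real: "cnj k * of_real s = k * of_real s" using Q by simp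
  obtain i where "i < n" "z $ i \<noteq> 0"
    using zn z0 by (metis carrier_vecD eq_vecI index_zero_vec)
  then have "s \<noteq> 0" unfolding s_def by (subst sum_nonneg_eq_0_iff) auto
  then have "cnj k = k" using real by simp
  then obtain r where r: "k = of_real r" using Reals_cnj_iff Reals_cases by metis
  have "poly (char_poly ?C) k = 0"
    using eigenvalue_root_char_poly[OF C] z unfolding eigenvalue_def by blast
  then have "poly (char_poly A) r = 0"
    by (simp add: of_real_hom.char_poly_hom[OF A] r)
  then show ?thesis
    using spectrum_root_char_poly[OF A] by auto
qed

text \<open>The triangle inequality together with its equality case: when the bound is attained, the
  terms \<open>1 - f x / a\<close> are nonnegative and sum to zero, so each of them vanishes. It
  serves twice below, with \<open>S\<close> the neighbours of a vertex and with \<open>S\<close> the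
  walks of length two from it.\<close>

lemma sum_eq_multiple_of_bound:
  fixes f :: "'b \<Rightarrow> real"
  assumes "finite S" "(\<Sum>x\<in>S. f x) = k * a" "\<And>x. x \<in> S \<Longrightarrow> \<bar>f x\<bar> \<le> \<bar>a\<bar>" "a \<noteq> 0"
  shows "\<bar>k\<bar> \<le> real (card S)"
    and "real (card S) \<le> k \<Longrightarrow> real (card S) = k \<and> (\<forall>x\<in>S. f x = a)"
proof -
  have "\<bar>k\<bar> * \<bar>a\<bar> \<le> (\<Sum>x\<in>S. \<bar>f x\<bar>)"
    using sum_abs[of f S] assms(2) by (simp add: abs_mult)
  also have "\<dots> \<le> card S * \<bar>a\<bar>" using sum_bounded_above[of S "\<lambda>x. \<bar>f x\<bar>"] assms(3) by simp
  finally show le: "\<bar>k\<bar> \<le> real (card S)" using \<open>a \<noteq> 0\<close> by simp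
  assume "real (card S) \<le> k"
  then have k: "k = real (card S)" using le by simp
  have nonneg: "0 \<le> 1 - f x / a" if "x \<in> S" for x
  proof -
    have "\<bar>f x / a\<bar> \<le> 1" using assms(3)[OF that] assms(4) by (simp add: abs_divide)
    then show ?thesis by linarith
  qed
  have "(\<Sum>x\<in>S. 1 - f x / a) = card S - (\<Sum>x\<in>S. f x) / a"
    by (simp add: sum_subtractf sum_divide_distrib)
  also have "\<dots> = 0" using assms(2,4) k by simp
  finally have sum0: "(\<Sum>x\<in>S. 1 - f x / a) = 0" .
  have "\<forall>x\<in>S. 1 - f x / a = 0"
    by (rule iffD1[OF sum_nonneg_eq_0_iff[OF assms(1) nonneg] sum0])
  then show "real (card S) = k \<and> (\<forall>x\<in>S. f x = a)"
    using k assms(4) by (simp add: field_simps)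
qed

section \<open>Eigenfunctions of a graph\<close>

abbreviation (in pair_pre_digraph) nbrs :: "'a \<Rightarrow> 'a set" where
  "nbrs v \<equiv> parcs G `` {v}"

text \<open>Eigenvectors of the adjacency matrix, indexed by vertices rather than by positions in an
  enumeration, so that the combinatorial arguments need no enumeration.\<close>

definition (in pair_pre_digraph) eigenfunction :: "real \<Rightarrow> ('a \<Rightarrow> real) \<Rightarrow> bool" where
  "eigenfunction k f \<longleftrightarrow> (\<exists>v\<in>pverts G. f v \<noteq> 0) \<and>
    (\<forall>v\<in>pverts G. (\<Sum>w\<in>nbrs v. f w) = k * f v)"

context pair_graph
begin

lemma parcs_sym: "(u, v) \<in> parcs G \<Longrightarrow> (v, u) \<in> parcs G"
  using pair_sym_arcs by (auto simp: symmetric_def dest: symD)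

lemma nbrs_sym: "v \<in> nbrs u \<Longrightarrow> u \<in> nbrs v"
  using parcs_sym by simp

lemma nbrs_subset: "nbrs v \<subseteq> pverts G"
  by (auto dest: in_arcsD2)

lemma finite_nbrs: "finite (nbrs v)"
  using finite_subset[OF nbrs_subset pair_finite_verts] .

lemma out_degree_eq: "out_degree (with_proj G) v = card (nbrs v)"
proof -
  have "out_arcs (with_proj G) v = Pair v ` nbrs v"
    unfolding out_arcs_def by auto
  then show ?thesis unfolding out_degree_def by (simp add: card_image inj_on_def)
qed

lemma card_nbrs_le_max_degree: "v \<in> pverts G \<Longrightarrow> card (nbrs v) \<le> max_degree (with_proj G)"
  unfolding max_degree_def out_degree_eq[symmetric] using pair_finite_verts by (intro Max_ge) auto

lemma max_degree_le_iff:
  "max_degree (with_proj G) \<le> d \<longleftrightarrow> (\<forall>v\<in>pverts G. card (nbrs v) \<le> d)"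
  unfolding max_degree_def out_degree_eq using pair_finite_verts by (subst Max_le_iff) auto

section \<open>The spectrum of the adjacency matrix in terms of eigenfunctions\<close>

lemma adjacency_matrix_carrier [simp]:
  "adjacency_matrix vs (with_proj G) \<in> carrier_mat (length vs) (length vs)"
  by (simp add: adjacency_matrix_def)

lemma spectrum_adjacency_matrix:
  assumes "distinct vs" "set vs = pverts G"
  shows "k \<in> spectrum (adjacency_matrix vs (with_proj G)) \<longleftrightarrow> (\<exists>f. eigenfunction k f)"
proof -
  let ?A = "adjacency_matrix vs (with_proj G)" and ?n = "length vs"
  have reindex: "(\<Sum>j<?n. ?A $$ (i, j) * f (vs ! j)) = (\<Sum>w\<in>nbrs (vs ! i). f w)"
    if "i < ?n" for i and f :: "'a \<Rightarrow> real"
  proof -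
    have "(\<Sum>j<?n. ?A $$ (i, j) * f (vs ! j))
      = (\<Sum>j<?n. if vs ! j \<in> nbrs (vs ! i) then f (vs ! j) else 0)"
      using that by (intro sum.cong) (auto simp: adjacency_matrix_def)
    also have "\<dots> = (\<Sum>w\<in>set vs. if w \<in> nbrs (vs ! i) then f w else 0)"
      by (rule sum.reindex_bij_betw) (rule bij_betw_nth[OF assms(1)], auto)
    also have "\<dots> = (\<Sum>w\<in>nbrs (vs ! i). f w)"
      unfolding assms(2) sum.inter_restrict[OF pair_finite_verts, symmetric]
      using nbrs_subset[of "vs ! i"] by (simp only: Int_absorb1)
    finally show ?thesis .
  qed
  show ?thesis
  proof
    assume "k \<in> spectrum ?A"
    then obtain x where x: "eigenvector ?A x k" unfolding spectrum_def eigenvalue_def by auto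
    have dim: "x \<in> carrier_vec ?n" "x \<noteq> 0\<^sub>v ?n"
      using x unfolding eigenvector_def by (auto simp: adjacency_matrix_def)
    \<comment> \<open>The description inverts the enumeration; as \<open>vs\<close> is distinct,
      every vertex has exactly one index.\<close>
    define f where "f v = x $ (THE i. i < ?n \<and> vs ! i = v)" for v
    have f: "f (vs ! i) = x $ i" if "i < ?n" for i
      unfolding f_def using that assms(1) by (subst the_equality[of _ i]) (auto simp: nth_eq_iff_index_eq)
    have "(\<Sum>w\<in>nbrs (vs ! i). f w) = k * f (vs ! i)" if "i < ?n" for i
      using eigenvector_sum[OF adjacency_matrix_carrier x that] reindex[OF that, of f] f that by simp
    then have "\<forall>v\<in>pverts G. (\<Sum>w\<in>nbrs v. f w) = k * f v"
      unfolding assms(2)[symmetric] all_set_conv_all_nth by blast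
    moreover obtain i where "i < ?n" "x $ i \<noteq> 0"
      using dim by (metis carrier_vecD eq_vecI index_zero_vec)
    ultimately have "eigenfunction k f"
      unfolding eigenfunction_def using f assms(2) nth_mem by metis
    then show "\<exists>f. eigenfunction k f" by blast
  next
    assume "\<exists>f. eigenfunction k f"
    then obtain f where f: "eigenfunction k f" by blast
    define x where "x = vec ?n (\<lambda>i. f (vs ! i))"
    obtain i where "i < ?n" "f (vs ! i) \<noteq> 0"
      using f unfolding eigenfunction_def assms(2)[symmetric] by (auto simp: in_set_conv_nth)
    then have "x $ i \<noteq> 0\<^sub>v ?n $ i" by (simp add: x_def)
    then have "x \<noteq> 0\<^sub>v ?n" by auto
    moreover have "?A *\<^sub>v x = k \<cdot>\<^sub>v x"
    proof
      fix i assume "i < dim_vec (k \<cdot>\<^sub>v x)"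
      then have i: "i < ?n" by (simp add: x_def)
      have "(?A *\<^sub>v x) $ i = (\<Sum>j<?n. ?A $$ (i, j) * f (vs ! j))"
        using i adjacency_matrix_carrier[of vs]
        by (simp add: scalar_prod_def x_def lessThan_atLeast0 adjacency_matrix_def)
      also have "\<dots> = k * f (vs ! i)"
        using reindex[OF i, of f] f i assms(2) unfolding eigenfunction_def by auto
      finally show "(?A *\<^sub>v x) $ i = (k \<cdot>\<^sub>v x) $ i" using i by (simp add: x_def)
    qed (simp add: x_def adjacency_matrix_def)
    ultimately have "eigenvector ?A x k"
      unfolding eigenvector_def by (simp add: x_def adjacency_matrix_def)
    then show "k \<in> spectrum ?A" unfolding spectrum_def eigenvalue_def by auto
  qed
qed

text \<open>The two properties through which the largest eigenvalue enters the theorem: the first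
  yields the upper bounds and the structure in case of equality, the second turns every explicit
  eigenfunction into a lower bound.\<close>

lemma largest_eigenvalue_adjacency_matrix:
  assumes "distinct vs" "set vs = pverts G" "pverts G \<noteq> {}"
  shows "\<exists>f. eigenfunction (largest_eigenvalue (adjacency_matrix vs (with_proj G))) f"
    and "eigenfunction k f \<Longrightarrow> k \<le> largest_eigenvalue (adjacency_matrix vs (with_proj G))"
proof -
  let ?A = "adjacency_matrix vs (with_proj G)"
  have fin: "finite (spectrum ?A)" by (rule card_finite_spectrum[OF adjacency_matrix_carrier])
  have "0 < length vs" using assms by auto
  then have "spectrum ?A \<noteq> {}"
    by (rule symmetric_spectrum_non_empty[OF adjacency_matrix_carrier])
      (auto simp: adjacency_matrix_def dest: parcs_sym)
  then show "\<exists>f. eigenfunction (largest_eigenvalue ?A) f"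
    unfolding spectrum_adjacency_matrix[OF assms(1,2), symmetric] largest_eigenvalue_def
    by (rule Max_in[OF fin])
  show "k \<le> largest_eigenvalue ?A" if "eigenfunction k f"
    unfolding largest_eigenvalue_def using that spectrum_adjacency_matrix[OF assms(1,2)]
    by (intro Max_ge[OF fin]) auto
qed

section \<open>Bounds on an eigenvalue at a vertex where the eigenfunction is largest in absolute
  value\<close>

lemma eigenfunction_peak:
  assumes "eigenfunction k f"
  obtains v where "v \<in> pverts G" "f v \<noteq> 0" "\<forall>w\<in>pverts G. \<bar>f w\<bar> \<le> \<bar>f v\<bar>"
proof -
  obtain u where u: "u \<in> pverts G" "f u \<noteq> 0" using assms unfolding eigenfunction_def by auto
  let ?I = "(\<lambda>w. \<bar>f w\<bar>) ` pverts G"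
  have "Max ?I \<in> ?I" using u pair_finite_verts by (intro Max_in) auto
  then obtain v where v: "v \<in> pverts G" "Max ?I = \<bar>f v\<bar>" by auto
  then have "\<forall>w\<in>pverts G. \<bar>f w\<bar> \<le> \<bar>f v\<bar>" using pair_finite_verts by (metis Max_ge finite_imageI imageI)
  with u v that show thesis by fastforce
qed

lemma eigenfunction_nbrs:
  assumes f: "eigenfunction k f"
    and v: "v \<in> pverts G" "f v \<noteq> 0" "\<forall>w\<in>pverts G. \<bar>f w\<bar> \<le> \<bar>f v\<bar>"
  shows "\<bar>k\<bar> \<le> real (card (nbrs v))"
    and "real (card (nbrs v)) \<le> k \<Longrightarrow> real (card (nbrs v)) = k \<and> (\<forall>w\<in>nbrs v. f w = f v)"
proof -
  have "(\<Sum>w\<in>nbrs v. f w) = k * f v" using f v(1) unfolding eigenfunction_def by auto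
  moreover have "\<bar>f w\<bar> \<le> \<bar>f v\<bar>" if "w \<in> nbrs v" for w using that v(3) nbrs_subset by blast
  ultimately have "\<bar>k\<bar> \<le> real (card (nbrs v)) \<and> (real (card (nbrs v)) \<le> k \<longrightarrow>
      real (card (nbrs v)) = k \<and> (\<forall>w\<in>nbrs v. f w = f v))"
    using sum_eq_multiple_of_bound[OF finite_nbrs, where f = f and a = "f v"] v(2) by metis
  then show "\<bar>k\<bar> \<le> real (card (nbrs v))"
    and "real (card (nbrs v)) \<le> k \<Longrightarrow> real (card (nbrs v)) = k \<and> (\<forall>w\<in>nbrs v. f w = f v)"
    by blast+
qed

text \<open>Applying the eigenvalue equation at \<open>v\<close> and then at its neighbours writes
  \<open>k\<^sup>2 * f v\<close> as a sum of values of \<open>f\<close>, one for each walk of length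
  two from \<open>v\<close>. End points count with multiplicity; \<open>v\<close> itself occurs once
  for each neighbour.\<close>

lemma eigenfunction_two_steps:
  assumes f: "eigenfunction k f"
    and v: "v \<in> pverts G" "f v \<noteq> 0" "\<forall>w\<in>pverts G. \<bar>f w\<bar> \<le> \<bar>f v\<bar>"
  shows "k\<^sup>2 \<le> real (\<Sum>w\<in>nbrs v. card (nbrs w))"
    and "real (\<Sum>w\<in>nbrs v. card (nbrs w)) \<le> k\<^sup>2 \<Longrightarrow>
      real (\<Sum>w\<in>nbrs v. card (nbrs w)) = k\<^sup>2 \<and> (\<forall>w\<in>nbrs v. \<forall>u\<in>nbrs w. f u = f v)"
proof -
  \<comment> \<open>A pair \<open>(w, u)\<close> in this set stands for the walk from
    \<open>v\<close> through \<open>w\<close> to \<open>u\<close>.\<close>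
  let ?S = "Sigma (nbrs v) nbrs"
  have fin: "finite ?S" using finite_nbrs by blast
  have card: "card ?S = (\<Sum>w\<in>nbrs v. card (nbrs w))"
    using finite_nbrs by (intro card_SigmaI) auto
  have "(\<Sum>p\<in>?S. f (snd p)) = (\<Sum>w\<in>nbrs v. \<Sum>u\<in>nbrs w. f u)"
    using finite_nbrs by (subst sum.Sigma) (auto simp: case_prod_beta)
  also have "\<dots> = (\<Sum>w\<in>nbrs v. k * f w)"
    using f nbrs_subset[of v] unfolding eigenfunction_def by (intro sum.cong) auto
  also have "\<dots> = k\<^sup>2 * f v"
    using f v(1) unfolding eigenfunction_def by (simp add: sum_distrib_left[symmetric] power2_eq_square)
  finally have sum: "(\<Sum>p\<in>?S. f (snd p)) = k\<^sup>2 * f v" .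
  have le: "\<bar>f (snd p)\<bar> \<le> \<bar>f v\<bar>" if "p \<in> ?S" for p using that v(3) nbrs_subset by fastforce
  show "k\<^sup>2 \<le> real (\<Sum>w\<in>nbrs v. card (nbrs w))"
    using sum_eq_multiple_of_bound(1)[OF fin sum le v(2)] card by simp
  show "real (\<Sum>w\<in>nbrs v. card (nbrs w)) = k\<^sup>2 \<and> (\<forall>w\<in>nbrs v. \<forall>u\<in>nbrs w. f u = f v)"
    if "real (\<Sum>w\<in>nbrs v. card (nbrs w)) \<le> k\<^sup>2"
    using sum_eq_multiple_of_bound(2)[OF fin sum le v(2)] that card by fastforce
qed

lemma eigenvalue_le_max_degree:
  assumes "eigenfunction k f" shows "k \<le> real (max_degree (with_proj G))"
proof -
  obtain v where v: "v \<in> pverts G" "f v \<noteq> 0" "\<forall>w\<in>pverts G. \<bar>f w\<bar> \<le> \<bar>f v\<bar>"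
    using eigenfunction_peak[OF assms] .
  show ?thesis using eigenfunction_nbrs(1)[OF assms v] card_nbrs_le_max_degree[OF v(1)] by linarith
qed

section \<open>Eigenvalues from regular unions of components and from stars\<close>

definition regular_part :: "nat \<Rightarrow> 'a set \<Rightarrow> bool" where
  "regular_part d M \<longleftrightarrow> M \<noteq> {} \<and> M \<subseteq> pverts G \<and> (\<forall>v\<in>M. card (nbrs v) = d \<and> nbrs v \<subseteq> M)"

text \<open>By symmetry of adjacency, a vertex outside the closed set \<open>M\<close> has no
  neighbour in \<open>M\<close>, so the neighbour sums are \<open>d\<close> on \<open>M\<close> and
  \<open>0\<close> elsewhere.\<close>

lemma eigenfunction_indicator:
  assumes "regular_part d M" shows "eigenfunction (real d) (\<lambda>v. of_bool (v \<in> M))"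
proof -
  have "(\<Sum>w\<in>nbrs v. (of_bool (w \<in> M) :: real)) = d * of_bool (v \<in> M)" for v
  proof (cases "v \<in> M")
    case True
    then have "(\<Sum>w\<in>nbrs v. (of_bool (w \<in> M) :: real)) = (\<Sum>w\<in>nbrs v. 1)"
      using assms unfolding regular_part_def by (intro sum.cong) auto
    then show ?thesis using True assms unfolding regular_part_def by simp
  next
    case False
    then have "w \<notin> M" if "w \<in> nbrs v" for w
      using that assms parcs_sym[of v w] unfolding regular_part_def by blast
    then have "(\<Sum>w\<in>nbrs v. (of_bool (w \<in> M) :: real)) = 0" by (intro sum.neutral) auto
    then show ?thesis using False by simp
  qed
  then show ?thesis using assms unfolding eigenfunction_def regular_part_def by force
qed

lemma regular_part_if_eigenvalue_eq_max_degree: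
  assumes f: "eigenfunction (real d) f" and d: "max_degree (with_proj G) = d"
  shows "\<exists>M. regular_part d M"
proof -
  obtain v where v: "v \<in> pverts G" "f v \<noteq> 0" "\<forall>w\<in>pverts G. \<bar>f w\<bar> \<le> \<bar>f v\<bar>"
    using eigenfunction_peak[OF f] .
  \<comment> \<open>A vertex sharing the value of \<open>v\<close> is itself a peak, and its degree
    is at most the eigenvalue \<open>d\<close>. The equality case applies there and passes the value
    on to its neighbours.\<close>
  have closed: "card (nbrs u) = d \<and> (\<forall>w\<in>nbrs u. f w = f u)" if "u \<in> pverts G" "f u = f v" for u
    using eigenfunction_nbrs(2)[OF f, of u] that v card_nbrs_le_max_degree[OF that(1)] d by auto
  have "regular_part d {u \<in> pverts G. f u = f v}"
    unfolding regular_part_def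
  proof (intro conjI ballI subsetI)
    show "{u \<in> pverts G. f u = f v} \<noteq> {}" using v(1) by blast
  next
    fix u w assume u: "u \<in> {u \<in> pverts G. f u = f v}" and w: "w \<in> nbrs u"
    then have "f w = f u" using closed by blast
    then show "w \<in> {u \<in> pverts G. f u = f v}" using u w in_arcsD2 by auto
  qed (use closed in auto)
  then show ?thesis ..
qed

text \<open>The centre carries the weight \<open>sqrt (card L)\<close> and each leaf the weight
  \<open>1\<close>: the centre sees \<open>card L\<close>, the square of its own weight, and a leaf
  sees the eigenvalue itself. For empty \<open>L\<close> this function would vanish everywhere on
  the graph.\<close>

lemma star_eigenfunction:
  assumes star: "parcs G = {c} \<times> L \<union> L \<times> {c}" "pverts G = insert c L" "c \<notin> L" "L \<noteq> {}"
  shows "eigenfunction (sqrt (card L)) (\<lambda>v. if v = c then sqrt (card L) else 1)"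
proof -
  have "nbrs c = L" "\<And>v. v \<in> L \<Longrightarrow> nbrs v = {c}" using star by auto
  moreover have "(\<Sum>w\<in>L. if w = c then sqrt (card L) else 1) = (\<Sum>w\<in>L. 1)"
    using star(3) by (intro sum.cong) auto
  ultimately have "(\<Sum>w\<in>nbrs v. if w = c then sqrt (card L) else 1) = sqrt (card L) * (if v = c then sqrt (card L) else 1)"
    if "v \<in> pverts G" for v
    using that star by (cases "v = c") auto
  then show ?thesis unfolding eigenfunction_def using star by (auto intro!: exI)
qed

end

section \<open>Graphs of girth at least five\<close>

locale girth5_graph = pair_graph +
  assumes girth5: "5 \<le> girth (with_proj G)"
begin

section \<open>Excluded cycles and counting within distance two\<close>

lemma no_short_cycle: "cycle p \<Longrightarrow> 3 \<le> length p \<Longrightarrow> 5 \<le> length p"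
proof -
  assume "cycle p" "3 \<le> length p"
  then have "girth (with_proj G) \<le> enat (length p)"
    unfolding girth_def by (intro INF_lower) auto
  with girth5 have "5 \<le> enat (length p)" by (rule order.trans)
  then show ?thesis by (simp add: numeral_eq_enat)
qed

lemma no_triangle:
  assumes "v \<in> nbrs u" "w \<in> nbrs v" shows "w \<notin> nbrs u"
proof
  assume "w \<in> nbrs u"
  then have "cycle [(u, v), (v, w), (w, u)]"
    using assms unfolding cycle_def awalk_def by (auto dest: parcs_sym no_loops' in_arcsD1 in_arcsD2)
  from no_short_cycle[OF this] show False by simp
qed

lemma no_square:
  assumes "v \<in> nbrs u" "v' \<in> nbrs u" "w \<in> nbrs v" "w \<in> nbrs v'" "w \<noteq> u"
  shows "v = v'"
proof (rule ccontr)
  assume "v \<noteq> v'"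
  then have "cycle [(u, v), (v, w), (w, v'), (v', u)]"
    using assms unfolding cycle_def awalk_def by (auto dest: parcs_sym no_loops' in_arcsD1 in_arcsD2)
  from no_short_cycle[OF this] show False by simp
qed

text \<open>The closed ball of radius two around \<open>v\<close>, split into \<open>v\<close> and
  one block for each neighbour so that its size can be read off.\<close>

definition ball2 :: "'a \<Rightarrow> 'a set" where
  "ball2 v = insert v (\<Union>w\<in>nbrs v. insert w (nbrs w - {v}))"

lemma ball2_subset: "v \<in> pverts G \<Longrightarrow> ball2 v \<subseteq> pverts G"
  unfolding ball2_def by (auto dest: in_arcsD2)

text \<open>The block of \<open>w\<close> arises from \<open>nbrs w\<close> by replacing
  \<open>v\<close> with \<open>w\<close>, so it has as many elements as \<open>nbrs w\<close>. A
  vertex common to two blocks would create a triangle or a 4-cycle through \<open>v\<close>.\<close>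

lemma card_ball2: "card (ball2 v) = Suc (\<Sum>w\<in>nbrs v. card (nbrs w))"
proof -
  let ?T = "\<lambda>w. insert w (nbrs w - {v})"
  have "card (\<Union>w\<in>nbrs v. ?T w) = (\<Sum>w\<in>nbrs v. card (?T w))"
  proof (rule card_UN_disjoint)
    show "\<forall>w\<in>nbrs v. \<forall>w'\<in>nbrs v. w \<noteq> w' \<longrightarrow> ?T w \<inter> ?T w' = {}"
      using no_triangle no_square by blast
  qed (use finite_nbrs in auto)
  also have "\<dots> = (\<Sum>w\<in>nbrs v. card (nbrs w))"
  proof (rule sum.cong)
    fix w assume "w \<in> nbrs v"
    then have "v \<in> nbrs w" "w \<notin> nbrs w" using parcs_sym no_loops' by auto
    then show "card (?T w) = card (nbrs w)"
      using finite_nbrs[of w] card_gt_0_iff[of "nbrs w"] by auto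
  qed simp
  finally have "card (\<Union>w\<in>nbrs v. ?T w) = (\<Sum>w\<in>nbrs v. card (nbrs w))" .
  moreover have "v \<notin> (\<Union>w\<in>nbrs v. ?T w)" using no_loops' by auto
  moreover have "finite (\<Union>w\<in>nbrs v. ?T w)" using finite_nbrs by blast
  ultimately show ?thesis unfolding ball2_def by simp
qed

section \<open>The square root bound and the graphs attaining it\<close>

lemma nbr_degree_sum_less: "v \<in> pverts G \<Longrightarrow> (\<Sum>w\<in>nbrs v. card (nbrs w)) < card (pverts G)"
  using card_mono[OF pair_finite_verts ball2_subset] card_ball2 by fastforce

lemma eigenvalue_le_sqrt:
  assumes f: "eigenfunction k f" shows "k \<le> sqrt (real (card (pverts G)) - 1)"
proof -
  obtain v where v: "v \<in> pverts G" "f v \<noteq> 0" "\<forall>w\<in>pverts G. \<bar>f w\<bar> \<le> \<bar>f v\<bar>"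
    using eigenfunction_peak[OF f] .
  have "k\<^sup>2 \<le> real (card (pverts G)) - 1"
    using eigenfunction_two_steps(1)[OF f v] nbr_degree_sum_less[OF v(1)] by linarith
  then show ?thesis by (rule real_le_rsqrt)
qed

text \<open>An edge between two neighbours of \<open>c\<close> would close a triangle. A graph with
  a single vertex is included, as a star without leaves.\<close>

lemma star_if_dominating_vertex:
  assumes "c \<in> pverts G" "pverts G \<subseteq> insert c (nbrs c)"
  shows "K\<^bsub>1,card (pverts G) - 1\<^esub> (with_proj G)"
proof -
  have V: "pverts G = {c} \<union> nbrs c" using assms nbrs_subset by auto
  have c: "{c} \<inter> nbrs c = {}" using no_loops' by auto
  have "parcs G = {c} \<times> nbrs c \<union> nbrs c \<times> {c}"
  proof (intro equalityI subsetI)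
    fix e assume "e \<in> parcs G"
    then obtain u v where "e = (u, v)" "(u, v) \<in> parcs G" "u \<in> {c} \<union> nbrs c" "v \<in> {c} \<union> nbrs c"
      using V in_arcsD1 in_arcsD2 by (metis surj_pair)
    then show "e \<in> {c} \<times> nbrs c \<union> nbrs c \<times> {c}" using no_triangle[of u c v] parcs_sym by auto
  qed (auto dest: parcs_sym)
  moreover have "card (nbrs c) = card (pverts G) - 1"
    using V c finite_nbrs[of c] by simp
  ultimately show ?thesis
    unfolding complete_bipartite_digraph_pair_def using V c pair_finite_verts
    by (intro conjI exI[of _ "{c}"] exI[of _ "nbrs c"]) simp_all
qed

text \<open>
  Outside the star case, the vertex \<open>i\<close> where \<open>\<bar>f\<bar>\<close> is maximal lies with \<open>j\<close> and any further neighbour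
  \<open>j'\<close> on a 5-cycle \<open>i, j, w, u, j'\<close>, and going around an odd cycle in steps of two reaches each of its
  vertices.
\<close>

lemma eigenvalue_eq_sqrt_cases:
  assumes f: "eigenfunction k f" and k: "k\<^sup>2 = real (card (pverts G)) - 1"
  shows "K\<^bsub>1,card (pverts G) - 1\<^esub> (with_proj G) \<or> regular_part (max_degree (with_proj G)) (pverts G)"
proof -
  obtain i where i: "i \<in> pverts G" "f i \<noteq> 0" "\<forall>w\<in>pverts G. \<bar>f w\<bar> \<le> \<bar>f i\<bar>"
    using eigenfunction_peak[OF f] .
  \<comment> \<open>Every vertex with the value \<open>f i\<close> is again a peak. There
    \<open>k\<^sup>2\<close> is at most the degree sum, which is at most
    \<open>n - 1 = k\<^sup>2\<close>. Equality in the second estimate makes the ball exhaust the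
    graph; equality in the first gives all ends of walks of length two the value
    \<open>f i\<close>.\<close>
  have peak: "ball2 v = pverts G \<and> (\<forall>w\<in>nbrs v. \<forall>u\<in>nbrs w. f u = f i)"
    if v: "v \<in> pverts G" "f v = f i" for v
  proof -
    have le: "real (\<Sum>w\<in>nbrs v. card (nbrs w)) \<le> k\<^sup>2"
      using nbr_degree_sum_less[OF v(1)] k by linarith
    have two: "real (\<Sum>w\<in>nbrs v. card (nbrs w)) = k\<^sup>2 \<and> (\<forall>w\<in>nbrs v. \<forall>u\<in>nbrs w. f u = f v)"
      using eigenfunction_two_steps(2)[OF f v(1) _ _ le] v i by simp
    then have "card (ball2 v) = card (pverts G)" using k card_ball2[of v] by linarith
    then have "ball2 v = pverts G"
      by (rule card_subset_eq[OF pair_finite_verts ball2_subset[OF v(1)]])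
    with two v show ?thesis by simp
  qed
  have Vi: "pverts G \<subseteq> insert i (\<Union>w\<in>nbrs i. insert w (nbrs w - {i}))"
    using peak[OF i(1)] unfolding ball2_def by auto
  show ?thesis
  proof (cases "\<forall>j\<in>nbrs i. nbrs j \<subseteq> {i}")
    case True
    then have "pverts G \<subseteq> insert i (nbrs i)" using Vi by blast
    then show ?thesis using star_if_dominating_vertex[OF i(1)] by blast
  next
    case False
    then obtain j w where j: "j \<in> nbrs i" and w: "w \<in> nbrs j" "w \<noteq> i" by blast
    have jV: "j \<in> pverts G" and wV: "w \<in> pverts G" using j w nbrs_subset by blast+
    have fw: "f w = f i" using peak[OF i(1) refl] j w(1) by blast
    have wi: "w \<notin> nbrs i" "i \<notin> nbrs w" using no_triangle[OF j w(1)] nbrs_sym by blast+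
    show ?thesis
    proof (cases "nbrs i = {j}")
      case True
      \<comment> \<open>If \<open>i\<close> is a leaf attached to \<open>j\<close>, everything
        within distance two of \<open>i\<close> is \<open>j\<close> or a neighbour of
        \<open>j\<close>, so the star has centre \<open>j\<close>.\<close>
      then have "pverts G \<subseteq> insert j (nbrs j)" using Vi nbrs_sym[OF j] by auto
      then show ?thesis using star_if_dominating_vertex[OF jV] by blast
    next
      case False
      have other: "f j' = f i \<and> f j = f i" if j': "j' \<in> nbrs i" "j' \<noteq> j" for j'
      proof -
        \<comment> \<open>As \<open>w\<close> is a peak, \<open>j'\<close> lies within distance two
          of it. Adjacency of \<open>j'\<close> and \<open>w\<close> would give the 4-cycle
          \<open>i, j, w, j'\<close>, so there is a middle vertex \<open>u\<close>, which closes the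
          5-cycle. The value then travels from \<open>i\<close> to \<open>u\<close>, from
          \<open>w\<close> to \<open>j'\<close> and from \<open>u\<close> to
          \<open>j\<close>.\<close>
        have "j' \<in> ball2 w" using peak[OF wV fw] j'(1) nbrs_subset by blast
        moreover have "j' \<noteq> w" using wi j' by auto
        moreover have "j' \<notin> nbrs w" using no_square[OF j j'(1) w(1) _ w(2)] j'(2) nbrs_sym[of j' w] by blast
        ultimately obtain u where u: "u \<in> nbrs w" "j' \<in> nbrs u" unfolding ball2_def by blast
        have uV: "u \<in> pverts G" using u nbrs_subset by blast
        have fu: "f u = f i" using peak[OF i(1) refl] j'(1) nbrs_sym[OF u(2)] by blast
        have "f j' = f i" using peak[OF wV fw] u by blast
        moreover have "f j = f i" using peak[OF uV fu] nbrs_sym[OF u(1)] nbrs_sym[OF w(1)] by blast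
        ultimately show ?thesis by simp
      qed
      have "f v = f i" if "v \<in> nbrs i" for v using other that False j by blast
      moreover have "f v = f i" if "w \<in> nbrs i" "v \<in> nbrs w" for v w
        using peak[OF i(1) refl] that by blast
      ultimately have const: "f v = f i" if "v \<in> pverts G" for v using Vi that by blast
      \<comment> \<open>For a constant nonzero eigenfunction the eigenvalue equation says that every
        degree is \<open>k\<close>.\<close>
      have deg: "real (card (nbrs v)) = k" if "v \<in> pverts G" for v
      proof -
        have "k * f i = (\<Sum>w\<in>nbrs v. f w)"
          using f that const[OF that] unfolding eigenfunction_def by simp
        also have "\<dots> = (\<Sum>w\<in>nbrs v. f i)" by (rule sum.cong) (auto intro: const in_arcsD2)
        finally show ?thesis using i(2) by simp
      qed
      have same: "card (nbrs v) = card (nbrs i)" if "v \<in> pverts G" for v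
        using deg[OF that] deg[OF i(1)] by linarith
      then have "max_degree (with_proj G) \<le> card (nbrs i)" by (simp add: max_degree_le_iff)
      then have "card (nbrs i) = max_degree (with_proj G)"
        using card_nbrs_le_max_degree[OF i(1)] by linarith
      with same have "card (nbrs v) = max_degree (with_proj G)" if "v \<in> pverts G" for v
        using that by (simp only:)
      then have "regular_part (max_degree (with_proj G)) (pverts G)"
        unfolding regular_part_def using i(1) nbrs_subset by auto
      then show ?thesis ..
    qed
  qed
qed

end

section \<open>Splitting a graph along a regular part\<close>

lemma girth_mono:
  assumes "pverts H \<subseteq> pverts G" "parcs H \<subseteq> parcs G"
  shows "girth (with_proj G) \<le> girth (with_proj H)"
  unfolding girth_def
proof (rule INF_superset_mono)
  show "{p. pre_digraph.cycle (with_proj H) p \<and> 3 \<le> length p}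
      \<subseteq> {p. pre_digraph.cycle (with_proj G) p \<and> 3 \<le> length p}"
    using assms unfolding pre_digraph.cycle_def pre_digraph.awalk_def
      cas_with_proj_eq awalk_verts_with_proj_eq with_proj_simps by blast
qed simp

text \<open>Restates condition (iii) as a property of the vertex set of \<open>G1\<close>. That set
  must be nonempty, since otherwise \<open>G2 = G\<close> would satisfy the condition for every
  graph; \<open>G2\<close> may be empty, so a regular graph qualifies.\<close>

lemma (in girth5_graph) regular_part_iff_union:
  assumes max: "max_degree (with_proj G) = d"
  shows "(\<exists>M. regular_part d M) \<longleftrightarrow>
      (\<exists>G1 G2 :: 'a pair_pre_digraph.
        pair_graph G1 \<and> pair_graph G2 \<and>
        pverts G1 \<noteq> {} \<and> pverts G1 \<inter> pverts G2 = {} \<and>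
        with_proj G = Digraph_Component.union (with_proj G1) (with_proj G2) \<and>
        regular_graph d (with_proj G1) \<and>
        max_degree (with_proj G2) \<le> d \<and>
        5 \<le> girth (with_proj G1) \<and> 5 \<le> girth (with_proj G2))"
    (is "_ \<longleftrightarrow> ?U")
proof
  assume "\<exists>M. regular_part d M"
  then obtain M where M: "M \<noteq> {}" "M \<subseteq> pverts G" "\<And>v. v \<in> M \<Longrightarrow> card (nbrs v) = d"
      "\<And>v w. v \<in> M \<Longrightarrow> w \<in> nbrs v \<Longrightarrow> w \<in> M"
    unfolding regular_part_def by blast
  \<comment> \<open>The subgraph induced on \<open>W\<close>, to be used for \<open>M\<close> and
    for its complement.\<close>
  define H where "H W = \<lparr>pverts = W, parcs = parcs G \<inter> W \<times> W\<rparr>" for W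
  have H [simp]: "pverts (H W) = W" "parcs (H W) = parcs G \<inter> W \<times> W" for W
    by (simp_all add: H_def)
  have graph: "pair_graph (H W)" if "W \<subseteq> pverts G" for W
  proof
    show "finite (pverts (H W))" by (simp add: finite_subset[OF that pair_finite_verts])
    show "finite (parcs (H W))" using pair_finite_arcs by simp
    show "symmetric (with_proj (H W))" unfolding symmetric_def by (auto intro!: symI dest: parcs_sym)
  qed (auto dest: no_loops')
  have girth: "5 \<le> girth (with_proj (H W))" if "W \<subseteq> pverts G" for W
    using girth_mono[of "H W" G] that girth5 by fastforce
  let ?G1 = "H M" and ?G2 = "H (pverts G - M)"
  \<comment> \<open>Since \<open>M\<close> is closed under the symmetric adjacency relation, no arc
    joins it to its complement in either direction.\<close>
  have "parcs G = parcs ?G1 \<union> parcs ?G2"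
    using M(4) parcs_sym by (auto dest: in_arcsD1 in_arcsD2)
  then have "with_proj G = Digraph_Component.union (with_proj ?G1) (with_proj ?G2)"
    using M(2) unfolding Digraph_Component.union_def with_proj_def by auto
  moreover have "regular_graph d (with_proj ?G1)"
    unfolding regular_graph_def pair_graph.out_degree_eq[OF graph[OF M(2)]]
  proof
    fix v assume "v \<in> verts (with_proj ?G1)"
    then have v: "v \<in> M" by simp
    then have "parcs ?G1 `` {v} = nbrs v" using M(4) by auto
    then show "card (parcs ?G1 `` {v}) = d" using M(3)[OF v] by simp
  qed
  moreover have "max_degree (with_proj ?G2) \<le> d"
  proof (subst pair_graph.max_degree_le_iff[OF graph], safe)
    fix v assume "v \<in> pverts ?G2"
    then have "card (nbrs v) \<le> d" using card_nbrs_le_max_degree[of v] max by auto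
    moreover have "card (parcs ?G2 `` {v}) \<le> card (nbrs v)" by (rule card_mono[OF finite_nbrs]) auto
    ultimately show "card (parcs ?G2 `` {v}) \<le> d" by linarith
  qed
  ultimately show ?U
    using M(1) graph[OF M(2)] girth[OF M(2)] graph[OF Diff_subset] girth[OF Diff_subset]
    by (intro exI[of _ ?G1] exI[of _ ?G2] conjI) (assumption | simp)+
next
  assume ?U
  then obtain G1 G2 where U: "pair_graph G1" "pair_graph G2" "pverts G1 \<noteq> {}"
      "pverts G1 \<inter> pverts G2 = {}"
      "with_proj G = Digraph_Component.union (with_proj G1) (with_proj G2)"
      "regular_graph d (with_proj G1)"
    by blast
  have V: "pverts G = pverts G1 \<union> pverts G2" and E: "parcs G = parcs G1 \<union> parcs G2"
    using arg_cong[OF U(5), of verts] arg_cong[OF U(5), of arcs]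
    by (simp_all add: Digraph_Component.union_def)
  interpret G1: pair_graph G1 by (rule U(1))
  interpret G2: pair_graph G2 by (rule U(2))
  \<comment> \<open>Arcs of \<open>G2\<close> start in \<open>G2\<close>, which is disjoint from
    \<open>G1\<close>, so a vertex of \<open>G1\<close> gains no neighbours in the union.\<close>
  have "nbrs v = G1.nbrs v" if "v \<in> pverts G1" for v
    using that U(4) E G2.in_arcsD1 by auto
  then have "regular_part d (pverts G1)"
    using U(3,6) V G1.nbrs_subset unfolding regular_part_def regular_graph_def G1.out_degree_eq by auto
  then show "\<exists>M. regular_part d M" ..
qed

section \<open>Combining the bounds with the equality cases\<close>

theorem theorem1:
  fixes G :: "'a pair_pre_digraph" and vs :: "'a list" and n \<Delta> :: nat and \<mu> :: real
  assumes "pair_graph G"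
    and "card (pverts G) = n" and "1 \<le> n"
    and "max_degree (with_proj G) = \<Delta>"
    and "5 \<le> girth (with_proj G)"
    and "distinct vs" and "set vs = pverts G"
    and "\<mu> = largest_eigenvalue (adjacency_matrix vs (with_proj G))"
  shows "\<mu> \<le> min (real \<Delta>) (sqrt (real n - 1)) \<and>
    (\<mu> = min (real \<Delta>) (sqrt (real n - 1)) \<longleftrightarrow>
      K\<^bsub>1,n - 1\<^esub> (with_proj G) \<or>
      moore_graph_diameter2 \<Delta> (with_proj G) \<or>
      (\<exists>G1 G2 :: 'a pair_pre_digraph.
        pair_graph G1 \<and> pair_graph G2 \<and>
        pverts G1 \<noteq> {} \<and> pverts G1 \<inter> pverts G2 = {} \<and>
        with_proj G = Digraph_Component.union (with_proj G1) (with_proj G2) \<and>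
        regular_graph \<Delta> (with_proj G1) \<and>
        max_degree (with_proj G2) \<le> \<Delta> \<and>
        5 \<le> girth (with_proj G1) \<and> 5 \<le> girth (with_proj G2)))"
proof -
  interpret pair_graph G by (rule assms(1))
  interpret girth5_graph G by unfold_locales (rule assms(5))
  let ?m = "min (real \<Delta>) (sqrt (real n - 1))"
  have ne: "pverts G \<noteq> {}" using assms(2,3) by auto
  note largest = largest_eigenvalue_adjacency_matrix[OF assms(6,7) ne, folded assms(8)]
  obtain f where f: "eigenfunction \<mu> f" using largest(1) by blast
  have bound: "\<mu> \<le> ?m"
    using eigenvalue_le_max_degree[OF f] eigenvalue_le_sqrt[OF f] assms(2,4) by simp
  \<comment> \<open>The indicator function makes \<Delta> an eigenvalue, so \<Delta> \<le> \<mu>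
    \<le> \<open>?m\<close> \<le> \<Delta>.\<close>
  have eq_if_regular_part: "\<mu> = ?m" if "\<exists>M. regular_part \<Delta> M"
    using that eigenfunction_indicator largest(2) bound by fastforce
  have "(\<mu> = ?m) \<longleftrightarrow> K\<^bsub>1,n - 1\<^esub> (with_proj G) \<or> moore_graph_diameter2 \<Delta> (with_proj G)
      \<or> (\<exists>M. regular_part \<Delta> M)"
  proof (intro iffI; (elim disjE)?)
    assume eq: "\<mu> = ?m"
    show "K\<^bsub>1,n - 1\<^esub> (with_proj G) \<or> moore_graph_diameter2 \<Delta> (with_proj G) \<or> (\<exists>M. regular_part \<Delta> M)"
    proof (cases "\<mu> = \<Delta>")
      case True
      then show ?thesis using regular_part_if_eigenvalue_eq_max_degree f assms(4) by blast
    next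
      case False
      then have "\<mu> = sqrt (real n - 1)" using eq by linarith
      then have "\<mu>\<^sup>2 = real (card (pverts G)) - 1" using assms(2,3) by simp
      from eigenvalue_eq_sqrt_cases[OF f this] show ?thesis using assms(2,4) by auto
    qed
  next
    assume "K\<^bsub>1,n - 1\<^esub> (with_proj G)"
    then obtain U L where UL: "pverts G = U \<union> L" "U \<inter> L = {}" "card U = 1" "card L = n - 1"
        "parcs G = U \<times> L \<union> L \<times> U"
      unfolding complete_bipartite_digraph_pair_def by blast
    obtain c where c: "U = {c}" using UL(3) by (auto simp: card_1_singleton_iff)
    show "\<mu> = ?m"
    \<comment> \<open>Without leaves \<open>n = 1\<close> and the star eigenfunction is zero; the
      single vertex is then handled as a regular part of degree \<open>0\<close>.\<close>
    proof (cases "L = {}")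
      case True
      then have "\<Delta> = 0" using max_degree_le_iff[of 0] UL(5) assms(4) by auto
      then have "regular_part \<Delta> (pverts G)" unfolding regular_part_def using ne True UL(5) by auto
      then show ?thesis using eq_if_regular_part by blast
    next
      case False
      then have "sqrt (card L) \<le> \<mu>"
        using star_eigenfunction[of c L] UL c by (intro largest(2)) auto
      then show ?thesis using bound UL(4) assms(3) by (simp add: of_nat_diff)
    qed
  next
    assume "moore_graph_diameter2 \<Delta> (with_proj G)"
    then have "regular_part \<Delta> (pverts G)"
      using ne nbrs_subset
      unfolding moore_graph_diameter2_def regular_graph_def regular_part_def out_degree_eq by auto
    then show "\<mu> = ?m" using eq_if_regular_part by blast
  qed (rule eq_if_regular_part)
  then show ?thesis using bound unfolding regular_part_iff_union[OF assms(4)] by blast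
qed

end
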